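(* Let $C$ be a bivariate copula with $\rho(C)=\rho$. Then \[ 0\leqslant\mu_\infty(C)\leqslant\begin{cases}\sqrt[3]{\dfrac{1+\rho}{12}}, & -1\leqslant\rho\leqslant-\frac59,\\[2mm] \dfrac13, & -\frac59\leqslant\rho\leqslant-\frac13,\\[2mm] \sqrt[3]{\dfrac{1-\rho}{36}}, & -\frac13\leqslant\rho\leqslant1,\end{cases} \] and the bounds are attained (for each $\rho\in[-1,1]$, both the lower and the upper bound are attained by some copula $C$ with $\rho(C)=\rho$).
   Context: For a bivariate copula $C$, the measure of asymmetry is $\mu_\infty(C)=\max_{u,v\in[0,1]}|C(u,v)-C(v,u)|$. For copulas $C_1,C_2$ the concordance function is $\mathcal{Q}(C_1,C_2)=4\int_{[0,1]^2}C_2(u,v)\,dC_1(u,v)-1$. Spearman's rho is $\rho(C)=3\,\mathcal{Q}(C,\Pi)$, where $\Pi(u,v)=uv$. *)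

theory Defs
  imports "HOL-Analysis.Analysis"
begin

(* Bivariate functions on the unit square are total functions real => real => real;
   their values outside the square never matter below. *)

definition box_volume :: "(real \<Rightarrow> real \<Rightarrow> real) \<Rightarrow> real \<Rightarrow> real \<Rightarrow> real \<Rightarrow> real \<Rightarrow> real" where
  "box_volume C a b c d = C b d - C a d - C b c + C a c"

definition copula :: "(real \<Rightarrow> real \<Rightarrow> real) \<Rightarrow> bool" where
  "copula C \<longleftrightarrow>
     (\<forall>t\<in>{0..1}. C t 0 = 0 \<and> C 0 t = 0) \<and>
     (\<forall>t\<in>{0..1}. C t 1 = t \<and> C 1 t = t) \<and>
     (\<forall>a b c d. 0 \<le> a \<and> a \<le> b \<and> b \<le> 1 \<and> 0 \<le> c \<and> c \<le> d \<and> d \<le> 1 \<longrightarrow> 0 \<le> box_volume C a b c d)"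

(* The Lebesgue-Stieltjes measure dC on the unit square: the extension to the Borel sets of the
   unit square of the set function [a,b] x [c,d] |-> box_volume C a b c d.  Closed boxes are
   harmless because a copula is continuous; compare interval_measure, the one-dimensional
   analogue on half-open intervals. *)
definition copula_measure :: "(real \<Rightarrow> real \<Rightarrow> real) \<Rightarrow> (real \<times> real) measure" where
  "copula_measure C =
     extend_measure ({0..1} \<times> {0..1})
       {(a, b, c, d). 0 \<le> a \<and> a \<le> b \<and> b \<le> 1 \<and> 0 \<le> c \<and> c \<le> d \<and> d \<le> 1}
       (\<lambda>(a, b, c, d). {a..b} \<times> {c..d})
       (\<lambda>(a, b, c, d). ennreal (box_volume C a b c d))"

definition concordance :: "(real \<Rightarrow> real \<Rightarrow> real) \<Rightarrow> (real \<Rightarrow> real \<Rightarrow> real) \<Rightarrow> real" where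
  "concordance C1 C2 = 4 * (\<integral>(u, v). C2 u v \<partial>copula_measure C1) - 1"

definition prod_copula :: "real \<Rightarrow> real \<Rightarrow> real" where
  "prod_copula u v = u * v"

definition spearman_rho :: "(real \<Rightarrow> real \<Rightarrow> real) \<Rightarrow> real" where
  "spearman_rho C = 3 * concordance C prod_copula"

(* For a copula this supremum is a maximum: see max_asymmetry_attained. *)
definition max_asymmetry :: "(real \<Rightarrow> real \<Rightarrow> real) \<Rightarrow> real" where
  "max_asymmetry C = (SUP (u, v)\<in>{0..1} \<times> {0..1}. \<bar>C u v - C v u\<bar>)"

(* Adjacent branches agree at -5/9 and at -1/3. *)
definition asymmetry_bound :: "real \<Rightarrow> real" where
  "asymmetry_bound r =
     (if r \<le> -5/9 then root 3 ((1 + r) / 12)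
      else if r \<le> -1/3 then 1/3
      else root 3 ((1 - r) / 36))"

lemma copula_Lipschitz_1:
  assumes "copula C" "0 \<le> u" "u \<le> u'" "u' \<le> 1" "0 \<le> v" "v \<le> 1"
  shows "\<bar>C u' v - C u v\<bar> \<le> u' - u"
proof -
  have "0 \<le> box_volume C u u' 0 v" "0 \<le> box_volume C u u' v 1"
    "C u 0 = 0" "C u' 0 = 0" "C u 1 = u" "C u' 1 = u'"
    using assms unfolding copula_def by auto
  then show ?thesis unfolding box_volume_def by linarith
qed

lemma copula_Lipschitz_2:
  assumes "copula C" "0 \<le> v" "v \<le> v'" "v' \<le> 1" "0 \<le> u" "u \<le> 1"
  shows "\<bar>C u v' - C u v\<bar> \<le> v' - v"
proof -
  have "0 \<le> box_volume C 0 u v v'" "0 \<le> box_volume C u 1 v v'"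
    "C 0 v = 0" "C 0 v' = 0" "C 1 v = v" "C 1 v' = v'"
    using assms unfolding copula_def by auto
  then show ?thesis unfolding box_volume_def by linarith
qed

lemma copula_Lipschitz:
  assumes C: "copula C" and "u \<in> {0..1}" "v \<in> {0..1}" "u' \<in> {0..1}" "v' \<in> {0..1}"
  shows "\<bar>C u v - C u' v'\<bar> \<le> \<bar>u - u'\<bar> + \<bar>v - v'\<bar>"
proof -
  have "\<bar>C u v - C u' v\<bar> \<le> \<bar>u - u'\<bar>"
    using copula_Lipschitz_1[OF C, of u u' v] copula_Lipschitz_1[OF C, of u' u v] assms
    by (cases "u \<le> u'") auto
  moreover have "\<bar>C u' v - C u' v'\<bar> \<le> \<bar>v - v'\<bar>"
    using copula_Lipschitz_2[OF C, of v v' u'] copula_Lipschitz_2[OF C, of v' v u'] assms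
    by (cases "v \<le> v'") auto
  ultimately show ?thesis by linarith
qed

lemma copula_continuous_on:
  assumes C: "copula C"
  shows "continuous_on ({0..1} \<times> {0..1}) (\<lambda>(u, v). C u v)"
proof -
  have "\<exists>d>0. \<forall>p'\<in>{0..1} \<times> {0..1}. dist p' p < d \<longrightarrow>
          dist (case p' of (u, v) \<Rightarrow> C u v) (case p of (u, v) \<Rightarrow> C u v) < e"
    if p: "p \<in> {0..1} \<times> {0..1}" and e: "e > 0" for p :: "real \<times> real" and e :: real
  proof (intro exI[of _ "e / 2"] conjI ballI impI)
    fix p' :: "real \<times> real"
    assume p': "p' \<in> {0..1} \<times> {0..1}" and d: "dist p' p < e / 2"
    have "\<bar>fst p' - fst p\<bar> < e / 2" "\<bar>snd p' - snd p\<bar> < e / 2"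
      using d dist_fst_le[of p' p] dist_snd_le[of p' p] by (auto simp: dist_real_def)
    moreover have "\<bar>C (fst p') (snd p') - C (fst p) (snd p)\<bar>
        \<le> \<bar>fst p' - fst p\<bar> + \<bar>snd p' - snd p\<bar>"
      using p p' by (intro copula_Lipschitz[OF C]) auto
    ultimately show "dist (case p' of (u, v) \<Rightarrow> C u v) (case p of (u, v) \<Rightarrow> C u v) < e"
      by (simp add: dist_real_def case_prod_beta)
  qed (use e in auto)
  then show ?thesis unfolding continuous_on_iff by blast
qed

lemma max_asymmetry_attained:
  assumes C: "copula C"
  shows "\<exists>u\<in>{0..1}. \<exists>v\<in>{0..1}. max_asymmetry C = \<bar>C u v - C v u\<bar> \<and>
           (\<forall>x\<in>{0..1}. \<forall>y\<in>{0..1}. \<bar>C x y - C y x\<bar> \<le> \<bar>C u v - C v u\<bar>)"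
proof -
  let ?S = "{0..1} \<times> {0..1} :: (real \<times> real) set"
  let ?f = "\<lambda>(u, v). \<bar>C u v - C v u\<bar>"
  have c1: "continuous_on ?S (\<lambda>p. C (fst p) (snd p))"
    using copula_continuous_on[OF C] by (simp add: case_prod_beta)
  have c2: "continuous_on ?S (\<lambda>p. C (snd p) (fst p))"
  proof -
    have "continuous_on ?S (\<lambda>p. (snd p, fst p))" by (intro continuous_intros)
    moreover have "(\<lambda>p. (snd p, fst p)) ` ?S \<subseteq> ?S" by auto
    ultimately show ?thesis using continuous_on_compose2[OF c1, of ?S "\<lambda>p. (snd p, fst p)"] by simp
  qed
  have "continuous_on ?S ?f"
    unfolding case_prod_beta by (intro continuous_intros c1 c2)
  moreover have "compact ?S" "?S \<noteq> {}"
    by (auto intro: compact_Times)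
  ultimately obtain p where p: "p \<in> ?S" "\<And>q. q \<in> ?S \<Longrightarrow> ?f q \<le> ?f p"
    using continuous_attains_sup[of ?S ?f] by blast
  have "max_asymmetry C = ?f p"
    unfolding max_asymmetry_def using p by (intro cSup_eq_maximum) blast+
  moreover have "\<bar>C x y - C y x\<bar> \<le> ?f p" if "x \<in> {0..1}" "y \<in> {0..1}" for x y
    using p(2)[of "(x, y)"] that by simp
  moreover obtain u v where "p = (u, v)" by (cases p)
  ultimately show ?thesis using p(1) by (intro bexI[of _ u] bexI[of _ v]) simp_all
qed

end

(* Spearman's rho is 12 * integral of C - 3, by exchanging the order of integration in
   uv = area of [0,u] x [0,v]; this needs the measure dC, which is the law of a pair (U, V) with
   U uniform and V the quantile transform of the conditional distribution of C given U, whose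
   distribution function consists of Radon-Nikodym densities.

   If C(a,b) - C(b,a) = e, then C lies above the least copula through (a, b, C(a,b)), whose integral
   is 1/6 + dt(t+d)/2 with t = C(a,b) and d = t - (a+b-1).  Both t and d are at least e, which bounds
   the integral of C from below by 1/6 + e^3.  The same estimate for the flipped copula
   u - C(u,1-v) at (b,1-a) has t, d >= e and max t d >= 2e, because e <= |a-b|, and bounds the integral
   of C from above by 1/3 - 3e^3.  Equality holds for least copulas and their flips; the plateau
   e = 1/3 is filled by convex combinations, as is the symmetric case between the two
   Frechet-Hoeffding bounds. *)

theory Submission
  imports Defs
begin

section \<open>Existence of the Stieltjes measure of a copula\<close>

text \<open>Both sides are finite on bounded half-open intervals and agree there; these intervals
  are stable under intersection and generate the Borel sets, so uniqueness of measures applies. It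
  serves to compare two Stieltjes measures whose distribution functions differ by a monotone
  function.\<close>

lemma interval_measure_add:
  fixes F G :: "real \<Rightarrow> real"
  assumes F: "\<And>x y. x \<le> y \<Longrightarrow> F x \<le> F y" "continuous_on UNIV F"
    and G: "\<And>x y. x \<le> y \<Longrightarrow> G x \<le> G y" "continuous_on UNIV G"
    and A: "A \<in> sets borel"
  shows "emeasure (interval_measure (\<lambda>x. F x + G x)) A =
         emeasure (interval_measure F) A + emeasure (interval_measure G) A"
proof -
  define N where "N = measure_of UNIV (sets borel)
    (\<lambda>A. emeasure (interval_measure F) A + emeasure (interval_measure G) A)"
  have sets_N [simp]: "sets N = sets borel"
    unfolding N_def using sets.sigma_sets_eq[of borel] by (simp add: sets_measure_of)
  have em: "emeasure N A = emeasure (interval_measure F) A + emeasure (interval_measure G) A"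
    if "A \<in> sets borel" for A
  proof (rule emeasure_measure_of[OF N_def])
    show "countably_additive (sets N)
      (\<lambda>A. emeasure (interval_measure F) A + emeasure (interval_measure G) A)"
      unfolding countably_additive_def
      by (auto simp: suminf_add[symmetric] suminf_emeasure)
  qed (use that in \<open>auto simp: positive_def\<close>)
  have right_cont: "continuous (at_right a) f" if "continuous_on UNIV f" for a and f :: "real \<Rightarrow> real"
    using that by (simp add: continuous_on_eq_continuous_within continuous_at_imp_continuous_within)
  have "interval_measure (\<lambda>x. F x + G x) = N"
  proof (rule measure_eqI_generator_eq[where E = "range (\<lambda>(a, b). {a<..b})" and \<Omega> = UNIV
        and A = "\<lambda>n. {- real n<..real n}"])
    show "Int_stable (range (\<lambda>(a, b). {a<..b::real}))"
    proof (rule Int_stableI)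
      fix X Y :: "real set"
      assume "X \<in> range (\<lambda>(a, b). {a<..b})" "Y \<in> range (\<lambda>(a, b). {a<..b})"
      then obtain a b c d where "X = {a<..b}" "Y = {c<..d}" by auto
      then have "X \<inter> Y = (\<lambda>(a, b). {a<..b}) (max a c, min b d)" by auto
      then show "X \<inter> Y \<in> range (\<lambda>(a, b). {a<..b})" by blast
    qed
    have bor: "sets borel = sigma_sets UNIV (range (\<lambda>(a, b). {a<..b::real}))"
      using borel_sigma_sets_Ioc by (metis sets_measure_of top_greatest Pow_UNIV)
    then show "sets (interval_measure (\<lambda>x. F x + G x)) = sigma_sets UNIV (range (\<lambda>(a, b). {a<..b}))"
      "sets N = sigma_sets UNIV (range (\<lambda>(a, b). {a<..b}))" by auto
    show "(\<Union>n. {- real n<..real n}) = UNIV"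
    proof -
      have "\<exists>n. - real n < x \<and> x \<le> real n" for x :: real
      proof -
        obtain n where "\<bar>x\<bar> < real n" using reals_Archimedean2 by blast
        then show ?thesis by (intro exI[of _ n]) linarith
      qed
      then show ?thesis by auto
    qed
    fix n :: nat
    show "emeasure (interval_measure (\<lambda>x. F x + G x)) {- real n<..real n} \<noteq> \<infinity>"
      by (subst emeasure_interval_measure_Ioc)
        (auto intro!: right_cont F G continuous_intros add_mono)
  next
    fix X :: "real set" assume "X \<in> range (\<lambda>(a, b). {a<..b})"
    then obtain a b where X: "X = {a<..b}" by auto
    show "emeasure (interval_measure (\<lambda>x. F x + G x)) X = emeasure N X"
    proof (cases "a \<le> b")
      case True
      have *: "continuous (at_right c) (\<lambda>x. F x + G x)" "continuous (at_right c) F"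
        "continuous (at_right c) G" for c
        by (auto intro!: right_cont F G continuous_intros)
      show ?thesis
        unfolding X using F(1)[OF True] G(1)[OF True] True
        by (simp add: em emeasure_interval_measure_Ioc * F(1) G(1) add_mono flip: ennreal_plus)
    qed (simp add: X)
  qed auto
  then show ?thesis using em[OF A] by simp
qed

lemma finite_interval_measure:
  fixes F :: "real \<Rightarrow> real"
  assumes F: "\<And>x y. x \<le> y \<Longrightarrow> F x \<le> F y" "continuous_on UNIV F" and bound: "\<And>x. \<bar>F x\<bar> \<le> B"
  shows "finite_measure (interval_measure F)"
proof
  have "(SUP n::nat. emeasure (interval_measure F) {- real n..real n}) = emeasure (interval_measure F) (\<Union>n::nat. {- real n..real n})"
    by (intro SUP_emeasure_incseq) (auto simp: incseq_def)
  also have "(\<Union>n::nat. {- real n..real n}) = UNIV"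
  proof -
    have "\<exists>n. - real n \<le> x \<and> x \<le> real n" for x :: real
    proof -
      obtain n where "\<bar>x\<bar> < real n" using reals_Archimedean2 by blast
      then show ?thesis by (intro exI[of _ n]) linarith
    qed
    then show ?thesis by auto
  qed
  finally have "emeasure (interval_measure F) UNIV =
      (SUP n::nat. emeasure (interval_measure F) {- real n..real n})" by simp
  also have "\<dots> \<le> ennreal (2 * B)"
  proof (rule SUP_least)
    fix n :: nat
    show "emeasure (interval_measure F) {- real n..real n} \<le> ennreal (2 * B)"
      using bound[of "real n"] bound[of "- real n"]
      by (subst emeasure_interval_measure_Icc) (auto intro!: F ennreal_leI)
  qed
  finally show "emeasure (interval_measure F) (space (interval_measure F)) \<noteq> \<infinity>"
    using ennreal_less_top by (auto simp: top_unique)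
qed

text \<open>On the set where \<open>g < f\<close> both integrals are finite, because that of
  \<open>f\<close> is. If this set had positive measure, the integral of \<open>g\<close> over it
  would be strictly smaller, against \<open>le\<close> applied to that same set.\<close>

lemma AE_le_if_density_le:
  assumes [measurable]: "f \<in> borel_measurable M" "g \<in> borel_measurable M"
    and fin: "(\<integral>\<^sup>+x. f x \<partial>M) \<noteq> \<infinity>"
    and le: "\<And>A. A \<in> sets M \<Longrightarrow> emeasure (density M f) A \<le> emeasure (density M g) A"
  shows "AE x in M. f x \<le> g x"
proof -
  let ?A = "{x \<in> space M. g x < f x}"
  have [measurable]: "?A \<in> sets M" by measurable
  have fA: "(\<integral>\<^sup>+x. f x * indicator ?A x \<partial>M) \<le> (\<integral>\<^sup>+x. g x * indicator ?A x \<partial>M)"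
    using le[of ?A] by (simp add: emeasure_density)
  have "(\<integral>\<^sup>+x. f x * indicator ?A x \<partial>M) \<le> (\<integral>\<^sup>+x. f x \<partial>M)"
    by (intro nn_integral_mono) (auto simp: indicator_def)
  moreover have "(\<integral>\<^sup>+x. g x * indicator ?A x \<partial>M) \<le> (\<integral>\<^sup>+x. f x * indicator ?A x \<partial>M)"
    by (intro nn_integral_mono) (auto simp: indicator_def)
  ultimately have fin_g: "(\<integral>\<^sup>+x. g x * indicator ?A x \<partial>M) \<noteq> \<infinity>"
    using fin by (auto simp: top_unique)
  have "AE x in M. f x * indicator ?A x \<le> g x * indicator ?A x"
  proof (rule ccontr)
    assume "\<not> (AE x in M. f x * indicator ?A x \<le> g x * indicator ?A x)"
    moreover have "AE x in M. g x * indicator ?A x \<le> f x * indicator ?A x"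
      by (auto simp: indicator_def)
    ultimately have "(\<integral>\<^sup>+x. g x * indicator ?A x \<partial>M) < (\<integral>\<^sup>+x. f x * indicator ?A x \<partial>M)"
      using fin_g by (intro nn_integral_less) auto
    then show False using fA by simp
  qed
  then show ?thesis
    using AE_space
  proof eventually_elim
    fix x assume "f x * indicator ?A x \<le> g x * indicator ?A x" "x \<in> space M"
    then show "f x \<le> g x" by (cases "g x < f x") auto
  qed
qed

section \<open>Slices of a copula and their Radon-Nikodym densities\<close>

definition proj01 :: "real \<Rightarrow> real" where
  "proj01 x = max 0 (min 1 x)"

text \<open>If \<open>C\<close> is the joint distribution function of (U, V), this is the law of U
  restricted to the event V \<le> v; for v = 1 it is the uniform law. Clamping by
  \<open>proj01\<close> extends the slice to a monotone continuous function on the whole line, as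
  \<open>interval_measure\<close> requires.\<close>

definition slice_measure :: "(real \<Rightarrow> real \<Rightarrow> real) \<Rightarrow> real \<Rightarrow> real measure" where
  "slice_measure C v = interval_measure (\<lambda>x. C (proj01 x) v)"

lemma proj01_in [simp]: "proj01 x \<in> {0..1}" "0 \<le> proj01 x" "proj01 x \<le> 1"
  by (auto simp: proj01_def)

lemma proj01_mono: "x \<le> y \<Longrightarrow> proj01 x \<le> proj01 y"
  by (auto simp: proj01_def)

lemma proj01_id [simp]: "x \<in> {0..1} \<Longrightarrow> proj01 x = x"
  by (auto simp: proj01_def)

lemma continuous_on_proj01: "continuous_on A proj01"
  unfolding proj01_def by (intro continuous_intros)

lemma copula_box_volume_nonneg:
  "copula C \<Longrightarrow> 0 \<le> a \<Longrightarrow> a \<le> b \<Longrightarrow> b \<le> 1 \<Longrightarrow> 0 \<le> c \<Longrightarrow> c \<le> d \<Longrightarrow> d \<le> 1 \<Longrightarrow> 0 \<le> box_volume C a b c d"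
  by (auto simp: copula_def)

lemma copula_boundary:
  assumes "copula C" "t \<in> {0..1}"
  shows "C t 0 = 0" "C 0 t = 0" "C t 1 = t" "C 1 t = t"
  using assms by (auto simp: copula_def)

lemma copula_mono:
  assumes C: "copula C" and "0 \<le> u" "u \<le> u'" "u' \<le> 1" "0 \<le> v" "v \<le> v'" "v' \<le> 1"
  shows "C u v \<le> C u' v'"
  using copula_box_volume_nonneg[OF C, of u u' 0 v] copula_box_volume_nonneg[OF C, of 0 u' v v']
    copula_boundary[OF C] assms
  by (auto simp: box_volume_def)

lemma copula_bounds:
  assumes C: "copula C" and "u \<in> {0..1}" "v \<in> {0..1}"
  shows "0 \<le> C u v" "u + v - 1 \<le> C u v" "C u v \<le> u" "C u v \<le> v"
  using copula_box_volume_nonneg[OF C, of 0 u 0 v] copula_box_volume_nonneg[OF C, of u 1 v 1]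
    copula_box_volume_nonneg[OF C, of 0 u v 1] copula_box_volume_nonneg[OF C, of u 1 0 v]
    copula_boundary[OF C] assms
  by (auto simp: box_volume_def)

lemma copula_continuous_on_slice:
  assumes C: "copula C" and v: "v \<in> {0..1}"
  shows "continuous_on A (\<lambda>x. C (proj01 x) v)"
proof -
  have "continuous_on A (\<lambda>x. (\<lambda>(u, v). C u v) (proj01 x, v))"
    by (rule continuous_on_compose2[OF copula_continuous_on[OF C]])
      (use v in \<open>auto intro!: continuous_intros continuous_on_proj01\<close>)
  then show ?thesis by simp
qed

lemma sets_slice_measure [simp, measurable_cong]: "sets (slice_measure C v) = sets borel"
  by (simp add: slice_measure_def)

lemma space_slice_measure [simp]: "space (slice_measure C v) = UNIV"
  by (simp add: slice_measure_def)

lemma emeasure_slice_measure_Icc: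
  assumes C: "copula C" and v: "v \<in> {0..1}" and ab: "0 \<le> a" "a \<le> b" "b \<le> 1"
  shows "emeasure (slice_measure C v) {a..b} = ennreal (C b v - C a v)"
  unfolding slice_measure_def using v ab
  by (subst emeasure_interval_measure_Icc)
    (auto intro!: copula_mono[OF C] proj01_mono copula_continuous_on_slice[OF C])

lemma finite_slice_measure:
  assumes C: "copula C" and v: "v \<in> {0..1}"
  shows "finite_measure (slice_measure C v)"
  unfolding slice_measure_def
proof (rule finite_interval_measure[where B = 1])
  fix x show "\<bar>C (proj01 x) v\<bar> \<le> 1"
    using copula_bounds[OF C, of "proj01 x" v] v by auto
qed (use v in \<open>auto intro!: copula_mono[OF C] proj01_mono copula_continuous_on_slice[OF C]\<close>)

text \<open>Nonnegative box volumes make \<open>C x v - C x q\<close> monotone in x, so the slice at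
  \<open>v\<close> is the slice at \<open>q\<close> plus a further measure.\<close>

lemma slice_measure_mono:
  assumes C: "copula C" and v: "0 \<le> q" "q \<le> v" "v \<le> 1" and A: "A \<in> sets borel"
  shows "emeasure (slice_measure C q) A \<le> emeasure (slice_measure C v) A"
proof -
  have "emeasure (interval_measure (\<lambda>x. C (proj01 x) q + (C (proj01 x) v - C (proj01 x) q))) A =
    emeasure (slice_measure C q) A + emeasure (interval_measure (\<lambda>x. C (proj01 x) v - C (proj01 x) q)) A"
    unfolding slice_measure_def
  proof (rule interval_measure_add[OF _ _ _ _ A])
    fix x y :: real assume "x \<le> y"
    then show "C (proj01 x) q \<le> C (proj01 y) q"
      using v by (intro copula_mono[OF C] proj01_mono) auto
    show "C (proj01 x) v - C (proj01 x) q \<le> C (proj01 y) v - C (proj01 y) q"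
      using copula_box_volume_nonneg[OF C, of "proj01 x" "proj01 y" q v] v proj01_mono[OF \<open>x \<le> y\<close>]
      by (auto simp: box_volume_def)
  qed (use v in \<open>auto intro!: copula_continuous_on_slice[OF C] continuous_intros\<close>)
  then show ?thesis by (simp add: slice_measure_def)
qed

text \<open>Domination by the slice at 1 gives absolute continuity and a density that is at most 1
  almost everywhere; truncating it makes the bounds hold everywhere. In probabilistic terms
  \<open>f x\<close> is the conditional probability of V \<le> v given U = x.\<close>

lemma slice_measure_density:
  assumes C: "copula C" and v: "v \<in> {0..1}"
  obtains f where "f \<in> borel_measurable borel" "\<And>x. 0 \<le> f x" "\<And>x. f x \<le> 1"
    "slice_measure C v = density (slice_measure C 1) (\<lambda>x. ennreal (f x))"
proof -
  let ?M = "slice_measure C 1"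
  interpret M: finite_measure ?M by (rule finite_slice_measure[OF C]) simp
  interpret N: finite_measure "slice_measure C v" by (rule finite_slice_measure[OF C v])
  have le: "emeasure (slice_measure C v) A \<le> emeasure ?M A" if "A \<in> sets borel" for A
    using v that by (intro slice_measure_mono[OF C]) auto
  have "absolutely_continuous ?M (slice_measure C v)"
    unfolding absolutely_continuous_def
  proof
    fix A assume "A \<in> null_sets ?M"
    then show "A \<in> null_sets (slice_measure C v)"
      using le[of A] by (auto simp: null_sets_def)
  qed
  then obtain g where g [measurable]: "g \<in> borel_measurable ?M" and dens: "density ?M g = slice_measure C v"
    using M.Radon_Nikodym[of "slice_measure C v"] by auto
  have "AE x in ?M. g x \<le> 1"
  proof (rule AE_le_if_density_le[of _ ?M "\<lambda>_. 1"])
    have "(\<integral>\<^sup>+x. g x \<partial>?M) = emeasure (density ?M g) UNIV"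
      by (simp add: emeasure_density)
    then show "(\<integral>\<^sup>+x. g x \<partial>?M) \<noteq> \<infinity>"
      using N.emeasure_finite[of UNIV] by (simp add: dens)
    show "emeasure (density ?M g) A \<le> emeasure (density ?M (\<lambda>_. 1)) A" if "A \<in> sets ?M" for A
      using le[of A] that by (simp add: dens density_1)
  qed (use g in auto)
  then have "AE x in ?M. g x = ennreal (enn2real (min 1 (g x)))"
    by eventually_elim (auto simp: min_def top_unique ennreal_enn2real_if)
  then have "density ?M g = density ?M (\<lambda>x. ennreal (enn2real (min 1 (g x))))"
    by (intro density_cong) auto
  moreover have "enn2real (min 1 (g x)) \<le> 1" for x
    by (rule enn2real_leI) auto
  moreover have "(\<lambda>x. enn2real (min 1 (g x))) \<in> borel_measurable borel"
  proof -
    have [measurable]: "g \<in> borel_measurable borel"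
      using g measurable_cong_sets[OF sets_slice_measure refl, of C 1 borel] by simp
    show ?thesis by measurable
  qed
  ultimately show thesis
    using dens by (intro that[of "\<lambda>x. enn2real (min 1 (g x))"]) simp_all
qed

text \<open>\<open>extend_measure\<close> falls back to the zero measure unless some measure has the
  prescribed values on boxes. Such a measure is built here as the law of (U, V), with V sampled from
  the conditional distribution given U.\<close>

lemma copula_measure_witness:
  assumes C: "copula C"
  obtains P where "sets P = sets (borel :: (real \<times> real) measure)"
    "\<And>a b c d. 0 \<le> a \<Longrightarrow> a \<le> b \<Longrightarrow> b \<le> 1 \<Longrightarrow> 0 \<le> c \<Longrightarrow> c \<le> d \<Longrightarrow> d \<le> 1 \<Longrightarrow>
       emeasure P ({a..b} \<times> {c..d}) = ennreal (box_volume C a b c d)"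
proof -
  define M where "M = slice_measure C 1"
  \<comment> \<open>The uniform law of the second coordinate in \<open>?D\<close>, which is
    independent of the first and drives the quantile transform \<open>V\<close>.\<close>
  define U where "U = density lborel (indicator {0..1::real})"
  have "\<exists>f. f \<in> borel_measurable borel \<and> (\<forall>x. 0 \<le> f x) \<and> (\<forall>x. f x \<le> (1::real)) \<and>
      slice_measure C v = density M (\<lambda>x. ennreal (f x))" if "v \<in> {0..1}" for v
    using slice_measure_density[OF C that] unfolding M_def by metis
  then obtain f where f_meas: "\<And>v. v \<in> {0..1} \<Longrightarrow> f v \<in> borel_measurable borel"
    and f01: "\<And>v x. v \<in> {0..1} \<Longrightarrow> 0 \<le> f v x \<and> f v x \<le> (1::real)"
    and f_dens: "\<And>v. v \<in> {0..1} \<Longrightarrow> slice_measure C v = density M (\<lambda>x. ennreal (f v x))"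
    by metis
  have [measurable_cong]: "sets M = sets borel" and [simp]: "space M = UNIV"
    by (simp_all add: M_def)
  have [measurable_cong]: "sets U = sets borel" and [simp]: "space U = UNIV"
    by (simp_all add: U_def)
  interpret M: finite_measure M unfolding M_def by (rule finite_slice_measure[OF C]) simp
  have U_UNIV: "emeasure U UNIV = 1"
    by (simp add: U_def emeasure_density)
  interpret U: finite_measure U
    by standard (simp add: U_UNIV)
  have U_less: "emeasure U {w. w < y} = ennreal y" if "0 \<le> y" "y \<le> 1" for y
  proof -
    have "emeasure U {w. w < y} = (\<integral>\<^sup>+x. indicator {0..1} x * indicator {w. w < y} x \<partial>lborel)"
      unfolding U_def by (subst emeasure_density) auto
    also have "\<dots> = (\<integral>\<^sup>+x. indicator {0..<y} x \<partial>lborel)"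
      using that by (intro nn_integral_cong) (auto split: split_indicator)
    finally show ?thesis using that by simp
  qed
  let ?D = "M \<Otimes>\<^sub>M U"
  interpret D: finite_measure ?D
  proof
    have "emeasure ?D (space M \<times> space U) \<noteq> \<infinity>"
      by (subst U.emeasure_pair_measure_Times)
        (use M.emeasure_finite[of UNIV] in \<open>auto simp: U_UNIV\<close>)
    then show "emeasure ?D (space ?D) \<noteq> \<infinity>" by (simp add: space_pair_measure)
  qed
  have sets_D [measurable_cong]: "sets ?D = sets (borel \<Otimes>\<^sub>M borel)"
    by (intro sets_pair_measure_cong) (simp_all add: M_def U_def)
  have [simp]: "space ?D = UNIV" by (simp add: space_pair_measure)

  define Q where "Q = \<rat> \<inter> {0..1::real}"
  have cQ: "countable Q" unfolding Q_def using countable_rat by blast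
  have Q01: "q \<in> {0..1}" if "q \<in> Q" for q using that by (auto simp: Q_def)
  (* For fixed x this is the generalized inverse of the conditional distribution function
     v \<mapsto> f v x at w; only countably many v may be used because the densities are
     monotone in v only almost everywhere. *)
  define V where "V p = Inf (insert 1 {q \<in> Q. snd p < f q (fst p)})" for p
  \<comment> \<open>The inserted 1 keeps the set under the infimum nonempty, and it produces the
    disjunct \<open>1 < v\<close>. The equivalence turns events about \<open>V\<close> into
    countable unions.\<close>
  have V_less: "V p < v \<longleftrightarrow> 1 < v \<or> (\<exists>q\<in>Q. q < v \<and> snd p < f q (fst p))" for p v
  proof -
    have "bdd_below (insert 1 {q \<in> Q. snd p < f q (fst p)})"
      by (rule bdd_belowI[of _ 0]) (use Q01 in auto)
    then show ?thesis
      unfolding V_def by (subst cInf_less_iff) auto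
  qed
  have f_sets: "{p. snd p < f q (fst p)} \<in> sets (borel \<Otimes>\<^sub>M borel)" if "q \<in> {0..1}" for q
  proof -
    note [measurable] = f_meas[OF that]
    have "{p \<in> space (borel \<Otimes>\<^sub>M borel). snd p < f q (fst p)} \<in> sets (borel \<Otimes>\<^sub>M borel)"
      by measurable
    then show ?thesis by (simp add: space_pair_measure)
  qed
  have V_sets: "{p. V p < v} \<in> sets (borel \<Otimes>\<^sub>M borel)" for v
  proof -
    have "{p. V p < v} = {p. 1 < v} \<union> (\<Union>q\<in>{q\<in>Q. q < v}. {p. snd p < f q (fst p)})"
      by (auto simp: V_less)
    moreover have "{p :: real \<times> real. 1 < v} \<in> sets (borel \<Otimes>\<^sub>M borel)"
      using sets.top[of "borel \<Otimes>\<^sub>M borel"] by (cases "1 < v") (simp_all add: space_pair_measure)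
    moreover have "(\<Union>q\<in>{q\<in>Q. q < v}. {p. snd p < f q (fst p)}) \<in> sets (borel \<Otimes>\<^sub>M borel)"
      using cQ Q01 by (intro sets.countable_UN'' f_sets) auto
    ultimately show ?thesis by auto
  qed
  have [measurable]: "V \<in> borel_measurable (borel \<Otimes>\<^sub>M borel)"
    using V_sets by (auto simp: borel_measurable_iff_less space_pair_measure)

  have slice: "emeasure (slice_measure C v) A = (\<integral>\<^sup>+x. ennreal (f v x) * indicator A x \<partial>M)"
    if "v \<in> {0..1}" "A \<in> sets borel" for v A
    using that f_meas[of v] by (simp add: f_dens emeasure_density)
  have AE_mono: "AE x in M. f q x \<le> f v x" if "0 \<le> q" "q \<le> v" "v \<le> 1" for q v
  proof -
    have qv: "q \<in> {0..1}" "v \<in> {0..1}" using that by auto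
    note [measurable] = f_meas[OF qv(1)] f_meas[OF qv(2)]
    interpret N: finite_measure "slice_measure C q" by (rule finite_slice_measure[OF C qv(1)])
    have "AE x in M. ennreal (f q x) \<le> ennreal (f v x)"
    proof (rule AE_le_if_density_le)
      show "(\<integral>\<^sup>+x. ennreal (f q x) \<partial>M) \<noteq> \<infinity>"
        using slice[OF qv(1), of UNIV] N.emeasure_finite[of UNIV] by simp
      show "emeasure (density M (\<lambda>x. ennreal (f q x))) A \<le> emeasure (density M (\<lambda>x. ennreal (f v x))) A"
        if "A \<in> sets M" for A
        using slice_measure_mono[OF C, of q v A] that \<open>0 \<le> q\<close> \<open>q \<le> v\<close> \<open>v \<le> 1\<close>
        by (simp add: f_dens[OF qv(1)] f_dens[OF qv(2)] M_def)
    qed simp_all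
    then show ?thesis using f01[OF qv(2)] by (simp add: ennreal_le_iff)
  qed

  have fst_sets: "{p. fst p \<in> A} \<in> sets (borel \<Otimes>\<^sub>M borel)" if [measurable]: "A \<in> sets borel" for A :: "real set"
  proof -
    have "{p \<in> space (borel \<Otimes>\<^sub>M borel). fst p \<in> A} \<in> sets (borel \<Otimes>\<^sub>M borel)"
      by measurable
    then show ?thesis by (simp add: space_pair_measure)
  qed
  have meas: "{p. fst p \<in> A \<and> V p < v} \<in> sets ?D" if "A \<in> sets borel" for A v
  proof -
    have "{p. fst p \<in> A} \<inter> {p. V p < v} \<in> sets ?D"
      unfolding sets_D by (intro sets.Int fst_sets V_sets that)
    then show ?thesis by (simp add: Int_def)
  qed
  \<comment> \<open>If V p < v, then the second coordinate is below \<open>f q x\<close> for some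
    rational q < v, hence below \<open>f v x\<close> outside one null set that serves all countably
    many q. The section at x thus has \<open>U\<close>-mass at most \<open>f v x\<close>.\<close>
  have upper: "emeasure ?D {p. fst p \<in> A \<and> V p < v} \<le> emeasure (slice_measure C v) A"
    if v: "v \<in> {0..1}" and A: "A \<in> sets borel" for v A
  proof -
    have "AE x in M. \<forall>q\<in>{q\<in>Q. q < v}. f q x \<le> f v x"
      using cQ v Q01 by (subst AE_ball_countable) (auto intro!: AE_mono)
    then have "AE x in M. emeasure U (Pair x -` {p. fst p \<in> A \<and> V p < v}) \<le> ennreal (f v x) * indicator A x"
    proof eventually_elim
      fix x assume x: "\<forall>q\<in>{q\<in>Q. q < v}. f q x \<le> f v x"
      show "emeasure U (Pair x -` {p. fst p \<in> A \<and> V p < v}) \<le> ennreal (f v x) * indicator A x"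
      proof (cases "x \<in> A")
        case True
        have "emeasure U (Pair x -` {p. fst p \<in> A \<and> V p < v}) \<le> emeasure U {w. w < f v x}"
          using x v by (intro emeasure_mono) (auto simp: V_less U_def intro: less_le_trans)
        then show ?thesis using True f01[OF v, of x] by (simp add: U_less)
      qed simp
    qed
    then show ?thesis
      using v A meas[OF A, of v]
      by (simp add: slice U.emeasure_pair_measure_alt nn_integral_mono_AE)
  qed
  \<comment> \<open>Conversely, a second coordinate below \<open>f q x\<close> with q < v forces V p
    < v, and such points have \<open>U\<close>-mass exactly \<open>f q x\<close>.\<close>
  have lower: "emeasure (slice_measure C q) A \<le> emeasure ?D {p. fst p \<in> A \<and> V p < v}"
    if q: "q \<in> Q" "q < v" and A: "A \<in> sets borel" for q v A
  proof -
    have "emeasure (slice_measure C q) A =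
        (\<integral>\<^sup>+x. emeasure U (Pair x -` ({p. fst p \<in> A} \<inter> {p. snd p < f q (fst p)})) \<partial>M)"
      unfolding slice[OF Q01[OF q(1)] A]
    proof (rule nn_integral_cong)
      fix x
      have "Pair x -` ({p. fst p \<in> A} \<inter> {p. snd p < f q (fst p)}) = (if x \<in> A then {w. w < f q x} else {})"
        by auto
      then show "ennreal (f q x) * indicator A x =
          emeasure U (Pair x -` ({p. fst p \<in> A} \<inter> {p. snd p < f q (fst p)}))"
        using f01[OF Q01[OF q(1)], of x] by (simp add: U_less)
    qed
    also have "\<dots> = emeasure ?D ({p. fst p \<in> A} \<inter> {p. snd p < f q (fst p)})"
      using fst_sets[OF A] f_sets[OF Q01[OF q(1)]]
      by (intro U.emeasure_pair_measure_alt[symmetric]) (auto simp: sets_D)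
    also have "\<dots> \<le> emeasure ?D {p. fst p \<in> A \<and> V p < v}"
      using q meas[OF A] by (intro emeasure_mono) (auto simp: V_less)
    finally show ?thesis .
  qed

  \<comment> \<open>Rational q close to v from below close the gap between \<open>upper\<close> and
    \<open>lower\<close>, by the Lipschitz property. Values v > 1, where the condition on
    \<open>V\<close> is void, are included because the box argument below looks slightly past d,
    which may be 1.\<close>
  have law: "measure ?D {p. fst p \<in> {a..b} \<and> V p < v} = C b (min v 1) - C a (min v 1)"
    if ab: "0 \<le> a" "a \<le> b" "b \<le> 1" and v: "0 \<le> v" for a b v
  proof (cases "v \<le> 1")
    case True
    let ?m = "measure ?D {p. fst p \<in> {a..b} \<and> V p < v}"
    have nonneg: "0 \<le> C b q - C a q" if "0 \<le> q" "q \<le> 1" for q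
      using copula_mono[OF C, of a b q q] ab that by auto
    have "?m \<le> C b v - C a v"
      using upper[of v "{a..b}"] v True ab nonneg[of v]
      by (simp add: emeasure_slice_measure_Icc[OF C] D.emeasure_eq_measure)
    moreover have "C b v - C a v \<le> ?m + e" if "e > 0" for e
    proof (cases "v = 0")
      case True
      then show ?thesis using copula_boundary[OF C] ab that by auto
    next
      case False
      then have "max 0 (v - e / 2) < v" using v that by auto
      then obtain q where q: "q \<in> \<rat>" "max 0 (v - e / 2) < q" "q < v"
        using Rats_dense_in_real by blast
      then have "q \<in> Q" using True by (auto simp: Q_def)
      have "C b q - C a q \<le> ?m"
        using lower[OF \<open>q \<in> Q\<close> q(3), of "{a..b}"] Q01[OF \<open>q \<in> Q\<close>] ab nonneg[of q]
        by (simp add: emeasure_slice_measure_Icc[OF C] D.emeasure_eq_measure)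
      moreover have "\<bar>C a v - C a q\<bar> \<le> v - q" "\<bar>C b v - C b q\<bar> \<le> v - q"
        using q True ab by (auto intro!: copula_Lipschitz_2[OF C])
      ultimately show ?thesis using q(2) by linarith
    qed
    then have "C b v - C a v \<le> ?m" by (rule field_le_epsilon)
    ultimately show ?thesis using True by (simp add: min_def)
  next
    case False
    have "{p. fst p \<in> {a..b} \<and> V p < v} = {a..b} \<times> UNIV"
      using False by (auto simp: V_less)
    then have "emeasure ?D {p. fst p \<in> {a..b} \<and> V p < v} = emeasure M {a..b}"
      by (simp add: U.emeasure_pair_measure_Times U_UNIV)
    also have "\<dots> = ennreal (C b 1 - C a 1)"
      unfolding M_def using ab by (simp add: emeasure_slice_measure_Icc[OF C])
    finally show ?thesis
      using False copula_mono[OF C, of a b 1 1] ab by (simp add: D.emeasure_eq_measure)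
  qed

  \<comment> \<open>The closed box lies between the strips c \<le> V < d and c \<le> V < d + e / 2,
    whose measures differ by at most e.\<close>
  have box: "measure ?D {p. fst p \<in> {a..b} \<and> V p \<in> {c..d}} = box_volume C a b c d"
    if abcd: "0 \<le> a" "a \<le> b" "b \<le> 1" "0 \<le> c" "c \<le> d" "d \<le> 1" for a b c d
  proof -
    let ?m = "measure ?D {p. fst p \<in> {a..b} \<and> V p \<in> {c..d}}"
    let ?S = "\<lambda>v. {p. fst p \<in> {a..b} \<and> V p < v}"
    have S: "?S v \<in> sets ?D" for v by (rule meas) simp
    have strip: "measure ?D (?S v - ?S c) = C b (min v 1) - C a (min v 1) - (C b c - C a c)"
      if "c \<le> v" for v
    proof -
      have "?S c \<subseteq> ?S v" using that by auto
      then have "measure ?D (?S v - ?S c) = measure ?D (?S v) - measure ?D (?S c)"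
        by (rule D.finite_measure_Diff[OF S S])
      then show ?thesis
        using law[of a b v] law[of a b c] that abcd by (simp add: min_absorb1)
    qed
    have box_sets: "{p. fst p \<in> {a..b} \<and> V p \<in> {c..d}} \<in> sets ?D"
    proof -
      have "{p \<in> space ?D. fst p \<in> {a..b} \<and> V p \<in> {c..d}} \<in> sets ?D" by measurable
      then show ?thesis by simp
    qed
    have "measure ?D (?S d - ?S c) \<le> ?m"
      by (rule D.finite_measure_mono[OF _ box_sets]) auto
    then have "box_volume C a b c d \<le> ?m"
      using abcd strip[of d] by (simp add: box_volume_def min_absorb1)
    moreover have "?m \<le> box_volume C a b c d + e" if "e > 0" for e
    proof -
      have "?m \<le> measure ?D (?S (d + e / 2) - ?S c)"
        using S that by (intro D.finite_measure_mono) auto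
      also have "\<dots> \<le> box_volume C a b c d + e"
      proof -
        have "\<bar>C a (min (d + e / 2) 1) - C a d\<bar> \<le> min (d + e / 2) 1 - d"
          "\<bar>C b (min (d + e / 2) 1) - C b d\<bar> \<le> min (d + e / 2) 1 - d"
          using abcd that by (auto intro!: copula_Lipschitz_2[OF C])
        then show ?thesis
          using strip[of "d + e / 2"] abcd that unfolding box_volume_def by linarith
      qed
      finally show ?thesis .
    qed
    then have "?m \<le> box_volume C a b c d" by (rule field_le_epsilon)
    ultimately show ?thesis by simp
  qed

  define P where "P = distr ?D borel (\<lambda>p. (fst p, V p))"
  have T: "(\<lambda>p. (fst p, V p)) \<in> ?D \<rightarrow>\<^sub>M borel"
    unfolding borel_prod[symmetric] by measurable
  show thesis
  proof (rule that[of P])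
    fix a b c d :: real assume abcd: "0 \<le> a" "a \<le> b" "b \<le> 1" "0 \<le> c" "c \<le> d" "d \<le> 1"
    have "{a..b} \<times> {c..d} \<in> sets (borel :: (real \<times> real) measure)"
      by (intro borel_closed closed_Times) auto
    then have "emeasure P ({a..b} \<times> {c..d}) = emeasure ?D {p. fst p \<in> {a..b} \<and> V p \<in> {c..d}}"
      unfolding P_def by (subst emeasure_distr[OF T]) (auto intro!: arg_cong[where f = "emeasure ?D"])
    also have "\<dots> = ennreal (box_volume C a b c d)"
      using box[OF abcd] by (simp add: D.emeasure_eq_measure)
    finally show "emeasure P ({a..b} \<times> {c..d}) = ennreal (box_volume C a b c d)" .
  qed (simp add: P_def)
qed

section \<open>Least copulas and flips\<close>

(* Pointwise least copula with value t at (a, b). *)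
definition least_copula_at :: "real \<Rightarrow> real \<Rightarrow> real \<Rightarrow> real \<Rightarrow> real \<Rightarrow> real" where
  "least_copula_at a b t u v = max (max 0 (u + v - 1)) (t - max 0 (a - u) - max 0 (b - v))"

text \<open>The distribution function of (U, 1 - V) when \<open>C\<close> is that of (U, V). It
  converts lower bounds on the integral of a copula into upper bounds.\<close>

definition flip :: "(real \<Rightarrow> real \<Rightarrow> real) \<Rightarrow> real \<Rightarrow> real \<Rightarrow> real" where
  "flip C u v = u - C u (1 - v)"

text \<open>The positive part is convex, so its increments grow with the argument. This is the
  rectangle inequality for the positive part of a sum.\<close>

lemma max_add_supermodular:
  fixes x x' y y' :: real
  assumes "x \<le> x'" "y \<le> y'"
  shows "0 \<le> max 0 (x' + y') - max 0 (x + y') - max 0 (x' + y) + max 0 (x + y)"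
  using assms by (auto simp: max_def)

lemma box_volume_split1: "box_volume C a b c d = box_volume C a x c d + box_volume C x b c d"
  by (simp add: box_volume_def)

lemma box_volume_split2: "box_volume C a b c d = box_volume C a b c y + box_volume C a b y d"
  by (simp add: box_volume_def)

text \<open>Volume is additive under cutting, and cuts at \<open>p\<close> and \<open>q\<close>
  leave pieces that each lie in one of the four quadrants around \<open>(p, q)\<close>.\<close>

lemma box_volume_nonneg_if_quadrants:
  assumes p: "p \<in> {0..1}" and q: "q \<in> {0..1}"
    and quad: "\<And>a b c d. 0 \<le> a \<Longrightarrow> a \<le> b \<Longrightarrow> b \<le> 1 \<Longrightarrow> 0 \<le> c \<Longrightarrow> c \<le> d \<Longrightarrow> d \<le> 1 \<Longrightarrow>
      b \<le> p \<or> p \<le> a \<Longrightarrow> d \<le> q \<or> q \<le> c \<Longrightarrow> 0 \<le> box_volume C a b c d"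
    and abcd: "0 \<le> a" "a \<le> b" "b \<le> 1" "0 \<le> c" "c \<le> d" "d \<le> 1"
  shows "0 \<le> box_volume C a b c d"
proof -
  have half: "0 \<le> box_volume C a b c d"
    if "0 \<le> a" "a \<le> b" "b \<le> 1" "b \<le> p \<or> p \<le> a" for a b
  proof (cases "c \<le> q \<and> q \<le> d")
    case True
    then show ?thesis
      using quad[of a b c q] quad[of a b q d] that abcd q box_volume_split2[of C a b c d q] by auto
  next
    case False
    then show ?thesis using quad[of a b c d] that abcd by auto
  qed
  show ?thesis
  proof (cases "a \<le> p \<and> p \<le> b")
    case True
    then show ?thesis
      using half[of a p] half[of p b] abcd p box_volume_split1[of C a b c d p] by auto
  next
    case False
    then show ?thesis using half[of a b] abcd by auto
  qed
qed

text \<open>In each quadrant around \<open>(a, b)\<close> the nested maxima collapse, up to an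
  additive constant, to the positive part of a monotone function of u plus a monotone function of v,
  so \<open>max_add_supermodular\<close> applies.\<close>

lemma copula_least_copula_at:
  assumes ab: "a \<in> {0..1}" "b \<in> {0..1}" and t: "0 \<le> t" "a + b - 1 \<le> t" "t \<le> a" "t \<le> b"
  shows "copula (least_copula_at a b t)"
  unfolding copula_def
proof (intro conjI ballI allI impI)
  fix u v :: real assume "u \<in> {0..1}"
  then show "least_copula_at a b t u 0 = 0" "least_copula_at a b t 0 u = 0"
    "least_copula_at a b t u 1 = u" "least_copula_at a b t 1 u = u"
    using ab t by (auto simp: least_copula_at_def max_def)
next
  fix p q r s :: real
  assume pqrs: "0 \<le> p \<and> p \<le> q \<and> q \<le> 1 \<and> 0 \<le> r \<and> r \<le> s \<and> s \<le> 1"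
  show "0 \<le> box_volume (least_copula_at a b t) p q r s"
  proof (rule box_volume_nonneg_if_quadrants[OF ab])
    fix p q r s :: real
    assume pq: "0 \<le> p" "p \<le> q" "q \<le> 1" and rs: "0 \<le> r" "r \<le> s" "s \<le> 1"
      and quad: "q \<le> a \<or> a \<le> p" "s \<le> b \<or> b \<le> r"
    consider "q \<le> a" "s \<le> b" | "a \<le> p" "s \<le> b" | "q \<le> a" "b \<le> r" | "a \<le> p" "b \<le> r"
      using quad by blast
    then show "0 \<le> box_volume (least_copula_at a b t) p q r s"
    proof cases
      case 1
      have "least_copula_at a b t u v = max 0 (u + (v + (t - a - b)))" if "u \<le> a" "v \<le> b" for u v
        using that t by (auto simp: least_copula_at_def max_def)
      then show ?thesis
        unfolding box_volume_def
        using 1 pq rs max_add_supermodular[of p q "r + (t - a - b)" "s + (t - a - b)"] by simp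
    next
      case 2
      have "least_copula_at a b t u v = max 0 (max (u - 1) (t - b) + v)" if "a \<le> u" "v \<le> b" for u v
        using that t by (auto simp: least_copula_at_def max_def)
      then show ?thesis
        unfolding box_volume_def
        using 2 pq rs max_add_supermodular[of "max (p - 1) (t - b)" "max (q - 1) (t - b)" r s] by simp
    next
      case 3
      have "least_copula_at a b t u v = max 0 (u + max (v - 1) (t - a))" if "u \<le> a" "b \<le> v" for u v
        using that t by (auto simp: least_copula_at_def max_def)
      then show ?thesis
        unfolding box_volume_def
        using 3 pq rs max_add_supermodular[of p q "max (r - 1) (t - a)" "max (s - 1) (t - a)"] by simp
    next
      case 4
      have "least_copula_at a b t u v = t + max 0 (u + (v - 1 - t))" if "a \<le> u" "b \<le> v" for u v
        using that t by (auto simp: least_copula_at_def max_def)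
      then show ?thesis
        unfolding box_volume_def
        using 4 pq rs max_add_supermodular[of p q "r - 1 - t" "s - 1 - t"] by simp
    qed
  qed (use pqrs in auto)
qed

text \<open>Moving from \<open>(a, b)\<close> to \<open>(u, v)\<close>, a copula loses at most the
  distance travelled downwards in each coordinate and loses nothing upwards.\<close>

lemma least_copula_at_le:
  assumes C: "copula C" and ab: "a \<in> {0..1}" "b \<in> {0..1}" and uv: "u \<in> {0..1}" "v \<in> {0..1}"
  shows "least_copula_at a b (C a b) u v \<le> C u v"
proof -
  have "C a b - max 0 (a - u) \<le> C u b"
    using copula_Lipschitz_1[OF C, of u a b] copula_mono[OF C, of a u b b] ab uv
    by (cases "u \<le> a") (auto simp: abs_le_iff)
  moreover have "C u b - max 0 (b - v) \<le> C u v"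
    using copula_Lipschitz_2[OF C, of v b u] copula_mono[OF C, of u u b v] ab uv
    by (cases "v \<le> b") (auto simp: abs_le_iff)
  ultimately show ?thesis
    using copula_bounds[OF C uv] by (auto simp: least_copula_at_def)
qed

lemma copula_flip:
  assumes C: "copula C"
  shows "copula (flip C)"
  unfolding copula_def
proof (intro conjI ballI allI impI)
  fix a b c d :: real
  assume "0 \<le> a \<and> a \<le> b \<and> b \<le> 1 \<and> 0 \<le> c \<and> c \<le> d \<and> d \<le> 1"
  then show "0 \<le> box_volume (flip C) a b c d"
    using copula_box_volume_nonneg[OF C, of a b "1 - d" "1 - c"] by (auto simp: box_volume_def flip_def)
qed (use copula_boundary[OF C] in \<open>auto simp: flip_def\<close>)

lemma copula_convex:
  assumes C: "copula C" and D: "copula D" and s: "0 \<le> s" "s \<le> 1"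
  shows "copula (\<lambda>u v. (1 - s) * C u v + s * D u v)"
  unfolding copula_def
proof (intro conjI ballI allI impI)
  fix a b c d :: real
  assume *: "0 \<le> a \<and> a \<le> b \<and> b \<le> 1 \<and> 0 \<le> c \<and> c \<le> d \<and> d \<le> 1"
  have "box_volume (\<lambda>u v. (1 - s) * C u v + s * D u v) a b c d =
      (1 - s) * box_volume C a b c d + s * box_volume D a b c d"
    by (simp add: box_volume_def algebra_simps)
  also have "\<dots> \<ge> 0"
    using * s copula_box_volume_nonneg[OF C] copula_box_volume_nonneg[OF D] by simp
  finally show "0 \<le> box_volume (\<lambda>u v. (1 - s) * C u v + s * D u v) a b c d" .
qed (use copula_boundary[OF C] copula_boundary[OF D] in \<open>auto simp: algebra_simps\<close>)

section \<open>Integrals of copulas over the unit square\<close>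

definition copula_integral :: "(real \<Rightarrow> real \<Rightarrow> real) \<Rightarrow> real" where
  "copula_integral C = integral (cbox (0, 0) (1, 1)) (\<lambda>(u, v). C u v)"

lemma cbox_unit_square: "cbox (0, 0) (1, 1) = {0..1 :: real} \<times> {0..1 :: real}"
  by (auto simp: cbox_Pair_eq)

lemma copula_integrable_on:
  "copula C \<Longrightarrow> (\<lambda>(u, v). C u v) integrable_on cbox (0, 0) (1, 1)"
  by (rule integrable_continuous) (simp add: cbox_unit_square copula_continuous_on)

lemma copula_integral_iterated:
  "copula C \<Longrightarrow> copula_integral C = integral {0..1} (\<lambda>u. integral {0..1} (C u))"
  unfolding copula_integral_def
  by (subst integral_prod_continuous) (simp_all add: cbox_unit_square copula_continuous_on)

lemma copula_integral_mono:
  assumes "copula C" "copula D" "\<And>u v. u \<in> {0..1} \<Longrightarrow> v \<in> {0..1} \<Longrightarrow> C u v \<le> D u v"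
  shows "copula_integral C \<le> copula_integral D"
  unfolding copula_integral_def using assms
  by (intro integral_le copula_integrable_on) (auto simp: cbox_unit_square)

lemma copula_integral_convex:
  assumes C: "copula C" and D: "copula D"
  shows "copula_integral (\<lambda>u v. (1 - s) * C u v + s * D u v) =
    (1 - s) * copula_integral C + s * copula_integral D"
proof -
  have "((\<lambda>p. (1 - s) * (case p of (u, v) \<Rightarrow> C u v) + s * (case p of (u, v) \<Rightarrow> D u v)) has_integral
      (1 - s) * copula_integral C + s * copula_integral D) (cbox (0, 0) (1, 1))"
    unfolding copula_integral_def
    by (intro has_integral_add has_integral_mult_right integrable_integral copula_integrable_on C D)
  then show ?thesis
    unfolding copula_integral_def[of "\<lambda>u v. (1 - s) * C u v + s * D u v"]
    by (intro integral_unique) (simp add: case_prod_unfold)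
qed

lemma copula_slice_integrable_on:
  assumes C: "copula C" and u: "u \<in> {0..1}"
  shows "C u integrable_on {0..1}"
proof (rule integrable_continuous_real)
  have "continuous_on {0..1} (\<lambda>v. (\<lambda>(u, v). C u v) (u, v))"
    by (rule continuous_on_compose2[OF copula_continuous_on[OF C]])
      (use u in \<open>auto intro!: continuous_intros\<close>)
  then show "continuous_on {0..1} (C u)" by simp
qed

lemma has_integral_reflect_unit:
  fixes f :: "real \<Rightarrow> real"
  assumes "(f has_integral I) {0..1}"
  shows "((\<lambda>x. f (1 - x)) has_integral I) {0..1}"
  using has_integral_affinity[of f I 0 1 "-1" 1] assms by simp

text \<open>Reflecting v preserves the inner integral, and u integrates to 1/2.\<close>

lemma copula_integral_flip:
  assumes C: "copula C"
  shows "copula_integral (flip C) = 1 / 2 - copula_integral C"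
proof -
  have inner: "integral {0..1} (flip C u) = u - integral {0..1} (C u)" if u: "u \<in> {0..1}" for u
  proof -
    have "(flip C u has_integral u - integral {0..1} (C u)) {0..1}"
      unfolding flip_def
      using has_integral_diff[OF has_integral_const_real[of u 0 1]
          has_integral_reflect_unit[OF integrable_integral[OF copula_slice_integrable_on[OF C u]]]]
      by simp
    then show ?thesis by (rule integral_unique)
  qed
  have "(\<lambda>u. integral (cbox 0 1) (\<lambda>v. (\<lambda>(u, v). C u v) (u, v))) integrable_on cbox (0::real) 1"
    by (intro integrable_continuous integral_continuous_on_param)
       (use copula_continuous_on[OF C] in simp)
  then have I: "(\<lambda>u. integral {0..1} (C u)) integrable_on {0..1}" by simp
  have "((\<lambda>u. u) has_integral 1\<^sup>2 / 2 - 0\<^sup>2 / 2) {0..1::real}"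
    by (intro fundamental_theorem_of_calculus)
      (auto intro!: derivative_eq_intros simp flip: has_real_derivative_iff_has_vector_derivative)
  then have "((\<lambda>u. u - integral {0..1} (C u)) has_integral 1 / 2 - copula_integral C) {0..1}"
    using has_integral_diff[OF _ integrable_integral[OF I]] copula_integral_iterated[OF C] by fastforce
  then have "integral {0..1} (\<lambda>u. integral {0..1} (flip C u)) = 1 / 2 - copula_integral C"
    using inner by (subst integral_cong[of _ _ "\<lambda>u. u - integral {0..1} (C u)"]) (auto intro: integral_unique)
  then show ?thesis by (simp add: copula_integral_iterated copula_flip[OF C])
qed

text \<open>Building block for the next lemma, where all slices and the correction
  \<open>\<phi>\<close> are combinations of such hinges.\<close>

lemma has_integral_hinge:
  fixes c :: real
  assumes "0 \<le> c" "c \<le> 1"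
  shows "((\<lambda>v. max 0 (v - c)) has_integral (1 - c)\<^sup>2 / 2) {0..1}"
proof -
  have "((\<lambda>v. 0) has_integral 0) {0..c}" by simp
  then have "((\<lambda>v. max 0 (v - c)) has_integral 0) {0..c}"
    by (rule has_integral_cong[THEN iffD1, rotated]) auto
  moreover have "((\<lambda>v. v - c) has_integral (1 - c)\<^sup>2 / 2 - (c - c)\<^sup>2 / 2) {c..1}"
    using assms by (intro fundamental_theorem_of_calculus)
      (auto intro!: derivative_eq_intros simp flip: has_real_derivative_iff_has_vector_derivative)
  then have "((\<lambda>v. max 0 (v - c)) has_integral (1 - c)\<^sup>2 / 2) {c..1}"
    by (rule has_integral_cong[THEN iffD1, rotated, THEN has_integral_eq_rhs]) auto
  ultimately show ?thesis
    using has_integral_combine[OF assms] by fastforce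
qed

lemma copula_integral_least_copula_at:
  assumes ab: "a \<in> {0..1}" "b \<in> {0..1}" and t: "0 \<le> t" "a + b - 1 \<le> t" "t \<le> a" "t \<le> b"
  defines "d \<equiv> t - (a + b - 1)"
  shows "copula_integral (least_copula_at a b t) = 1 / 6 + d * t * (t + d) / 2"
proof -
  \<comment> \<open>The excess of the slice integral over u^2 / 2, the slice integral of the lower
    Frechet-Hoeffding bound. It is a tent over [a - t, a + d] with peak d * t at u = a, so its area
    is d * t * (t + d) / 2.\<close>
  define \<phi> where "\<phi> u = d * max 0 (u - (a - t)) - (d + t) * max 0 (u - a) + t * max 0 (u - (a + d))" for u
  have inner: "(least_copula_at a b t u has_integral u\<^sup>2 / 2 + \<phi> u) {0..1}" if u: "u \<in> {0..1}" for u
  proof -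
    note hinge = has_integral_add[OF has_integral_diff[OF has_integral_hinge has_integral_hinge] has_integral_hinge]
    consider "u \<le> a - t" | "a + d \<le> u" | "a - t \<le> u" "u \<le> a" | "a \<le> u" "u \<le> a + d"
      by linarith
    then show ?thesis
    proof cases
      case 1
      have "\<phi> u = 0" using 1 t by (simp add: \<phi>_def d_def)
      moreover have "((\<lambda>v. max 0 (v - (1 - u))) has_integral u\<^sup>2 / 2) {0..1}"
        using has_integral_hinge[of "1 - u"] u by simp
      moreover have "least_copula_at a b t u v = max 0 (v - (1 - u))" if "v \<in> {0..1}" for v
        using that u ab t 1 by (auto simp: least_copula_at_def max_def)
      ultimately show ?thesis using has_integral_eq[of "{0..1}" _ "least_copula_at a b t u"] by simp
    next
      case 2
      have "\<phi> u = 0" using 2 t by (simp add: \<phi>_def d_def algebra_simps)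
      moreover have "((\<lambda>v. max 0 (v - (1 - u))) has_integral u\<^sup>2 / 2) {0..1}"
        using has_integral_hinge[of "1 - u"] u by simp
      moreover have "least_copula_at a b t u v = max 0 (v - (1 - u))" if "v \<in> {0..1}" for v
        using that u ab t 2 by (auto simp: least_copula_at_def max_def d_def)
      ultimately show ?thesis using has_integral_eq[of "{0..1}" _ "least_copula_at a b t u"] by simp
    next
      case 3
      \<comment> \<open>The slice climbs with slope 1 up to v = b, stays flat until u + v - 1
        overtakes it, then climbs again; the hinges sit at these breakpoints. The next case has the
        same shape with plateau height t.\<close>
      let ?h = "\<lambda>v. max 0 (v - (b - (u + t - a))) - max 0 (v - b) + max 0 (v - (1 + t - a))"
      have "(?h has_integral (1 - (b - (u + t - a)))\<^sup>2 / 2 - (1 - b)\<^sup>2 / 2 + (1 - (1 + t - a))\<^sup>2 / 2) {0..1}"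
        using u ab t 3 by (intro hinge) auto
      moreover have "(1 - (b - (u + t - a)))\<^sup>2 / 2 - (1 - b)\<^sup>2 / 2 + (1 - (1 + t - a))\<^sup>2 / 2 = u\<^sup>2 / 2 + \<phi> u"
        using 3 t by (simp add: \<phi>_def d_def) (simp add: field_simps power2_eq_square)
      moreover have "least_copula_at a b t u v = ?h v" if "v \<in> {0..1}" for v
        using that u ab t 3 by (auto simp: least_copula_at_def max_def)
      ultimately show ?thesis using has_integral_eq[of "{0..1}" _ "least_copula_at a b t u"] by simp
    next
      case 4
      let ?h = "\<lambda>v. max 0 (v - (b - t)) - max 0 (v - b) + max 0 (v - (1 - u + t))"
      have "(?h has_integral (1 - (b - t))\<^sup>2 / 2 - (1 - b)\<^sup>2 / 2 + (1 - (1 - u + t))\<^sup>2 / 2) {0..1}"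
        using u ab t 4 by (intro hinge) auto
      moreover have "(1 - (b - t))\<^sup>2 / 2 - (1 - b)\<^sup>2 / 2 + (1 - (1 - u + t))\<^sup>2 / 2 = u\<^sup>2 / 2 + \<phi> u"
        using 4 t by (simp add: \<phi>_def d_def) (simp add: field_simps power2_eq_square)
      moreover have "least_copula_at a b t u v = ?h v" if "v \<in> {0..1}" for v
        using that u ab t 4 by (auto simp: least_copula_at_def max_def d_def)
      ultimately show ?thesis using has_integral_eq[of "{0..1}" _ "least_copula_at a b t u"] by simp
    qed
  qed
  have "((\<lambda>u. u\<^sup>2 / 2) has_integral 1 ^ 3 / 6 - 0 ^ 3 / 6) {0..1::real}"
    by (intro fundamental_theorem_of_calculus)
      (auto intro!: derivative_eq_intros simp flip: has_real_derivative_iff_has_vector_derivative)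
  then have "((\<lambda>u. u\<^sup>2 / 2 + \<phi> u) has_integral 1 ^ 3 / 6 - 0 ^ 3 / 6 +
      (d * ((1 - (a - t))\<^sup>2 / 2) - (d + t) * ((1 - a)\<^sup>2 / 2) + t * ((1 - (a + d))\<^sup>2 / 2))) {0..1}"
    unfolding \<phi>_def using ab t
    by (intro has_integral_add has_integral_diff has_integral_mult_right has_integral_hinge)
      (auto simp: d_def)
  then have "integral {0..1} (\<lambda>u. u\<^sup>2 / 2 + \<phi> u) = 1 / 6 + d * t * (t + d) / 2"
    by (subst integral_unique) (auto simp: field_simps power2_eq_square)
  then show ?thesis
    using integral_cong[of "{0..1}" "\<lambda>u. integral {0..1} (least_copula_at a b t u)", OF integral_unique[OF inner]]
      copula_integral_iterated[OF copula_least_copula_at[OF ab t]]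
    by simp
qed

section \<open>Spearman's rho as a Lebesgue integral\<close>

lemma space_copula_measure [simp]: "space (copula_measure C) = {0..1} \<times> {0..1}"
  unfolding copula_measure_def by (subst space_extend_measure) auto

lemma box_in_sets_copula_measure:
  "0 \<le> a \<Longrightarrow> a \<le> b \<Longrightarrow> b \<le> 1 \<Longrightarrow> 0 \<le> c \<Longrightarrow> c \<le> d \<Longrightarrow> d \<le> 1 \<Longrightarrow>
    {a..b} \<times> {c..d} \<in> sets (copula_measure C)"
  unfolding copula_measure_def
  by (subst sets_extend_measure) (auto intro!: sigma_sets.Basic image_eqI[where x = "(a, b, c, d)"])

text \<open>The sigma-algebra generated by the boxes inside the square consists of Borel sets, so
  the witness \<open>P\<close> restricts to it and supplies the extension that
  \<open>extend_measure\<close> asks for.\<close>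

lemma emeasure_copula_measure:
  assumes C: "copula C" and abcd: "0 \<le> a" "a \<le> b" "b \<le> 1" "0 \<le> c" "c \<le> d" "d \<le> 1"
  shows "emeasure (copula_measure C) ({a..b} \<times> {c..d}) = ennreal (box_volume C a b c d)"
proof -
  obtain P where P: "sets P = sets (borel :: (real \<times> real) measure)"
    and box: "\<And>a b c d. 0 \<le> a \<Longrightarrow> a \<le> b \<Longrightarrow> b \<le> 1 \<Longrightarrow> 0 \<le> c \<Longrightarrow> c \<le> d \<Longrightarrow> d \<le> 1 \<Longrightarrow>
       emeasure P ({a..b} \<times> {c..d}) = ennreal (box_volume C a b c d)"
    using copula_measure_witness[OF C] by blast
  let ?I = "{(a, b, c, d). 0 \<le> a \<and> a \<le> b \<and> b \<le> 1 \<and> 0 \<le> c \<and> c \<le> d \<and> d \<le> (1::real)}"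
  let ?G = "\<lambda>(a, b, c, d). {a..b::real} \<times> {c..d::real}"
  have cbox: "{a..b} \<times> {c..d} \<in> sets P" for a b c d :: real
    unfolding P by (intro borel_closed closed_Times) auto
  have sets_K: "sets (copula_measure C) = sigma_sets ({0..1} \<times> {0..1}) (?G ` ?I)"
    unfolding copula_measure_def by (subst sets_extend_measure) auto
  have sub: "A \<in> sets P" if "A \<in> sets (copula_measure C)" for A
    using that unfolding sets_K by induction (auto intro: cbox)
  have "emeasure (copula_measure C) (?G (a, b, c, d)) = (\<lambda>(a, b, c, d). ennreal (box_volume C a b c d)) (a, b, c, d)"
  proof (rule emeasure_extend_measure[OF copula_measure_def])
    show "countably_additive (sets (copula_measure C)) (emeasure P)"
      unfolding countably_additive_def using sub by (auto intro!: suminf_emeasure)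
  qed (use abcd in \<open>auto simp: box positive_def\<close>)
  then show ?thesis by simp
qed

text \<open>A closed half-plane bounded by a line parallel to an axis meets the square in a closed
  box or not at all, hence in a generator or the empty set.\<close>

lemma measurable_copula_measure:
  "fst \<in> borel_measurable (copula_measure C)" "snd \<in> borel_measurable (copula_measure C)"
proof -
  let ?K = "copula_measure C"
  have "{p \<in> space ?K. s \<le> fst p} \<in> sets ?K" "{p \<in> space ?K. s \<le> snd p} \<in> sets ?K" for s
  proof -
    have *: "{p \<in> space ?K. s \<le> fst p} = (if s \<le> 1 then {max 0 s..1} \<times> {0..1} else {})"
      "{p \<in> space ?K. s \<le> snd p} = (if s \<le> 1 then {0..1} \<times> {max 0 s..1} else {})"
      by auto
    show "{p \<in> space ?K. s \<le> fst p} \<in> sets ?K" "{p \<in> space ?K. s \<le> snd p} \<in> sets ?K"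
      unfolding * by (auto intro!: box_in_sets_copula_measure)
  qed
  then show "fst \<in> borel_measurable ?K" "snd \<in> borel_measurable ?K"
    by (auto simp: borel_measurable_iff_ge)
qed

text \<open>By symmetry \<open>1 - s - t\<close> integrates to 0, so the survival function of a
  copula has the same integral as the copula itself.\<close>

lemma integral_survival_copula:
  assumes C: "copula C"
  shows "((\<lambda>(s, t). 1 - s - t + C s t) has_integral copula_integral C) (cbox (0, 0) (1, 1))"
proof -
  let ?f = "\<lambda>(s, t). 1 - s - t :: real"
  have f: "continuous_on (cbox (0, 0) (1, 1)) ?f"
    unfolding case_prod_beta by (intro continuous_intros)
  have "integral (cbox (0, 0) (1, 1)) ?f = integral {0..1} (\<lambda>s. integral {0..1} (\<lambda>t. 1 - s - t))"
    by (subst integral_prod_continuous[OF f]) simp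
  also have "\<dots> = integral {0..1} (\<lambda>s. 1 / 2 - s)"
  proof (rule integral_cong)
    fix s :: real
    have "((\<lambda>t. 1 - s - t) has_integral ((1 - s) * 1 - 1\<^sup>2 / 2) - ((1 - s) * 0 - 0\<^sup>2 / 2)) {0..1}"
      by (intro fundamental_theorem_of_calculus)
        (auto intro!: derivative_eq_intros simp flip: has_real_derivative_iff_has_vector_derivative)
    then show "integral {0..1} (\<lambda>t. 1 - s - t) = 1 / 2 - s"
      by (subst integral_unique) auto
  qed
  also have "\<dots> = 0"
  proof -
    have "((\<lambda>s. 1 / 2 - s) has_integral (1 / 2 * 1 - 1\<^sup>2 / 2) - (1 / 2 * 0 - 0\<^sup>2 / 2)) {0..1::real}"
      by (intro fundamental_theorem_of_calculus)
        (auto intro!: derivative_eq_intros simp flip: has_real_derivative_iff_has_vector_derivative)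
    then show ?thesis by (subst integral_unique) auto
  qed
  finally have "(?f has_integral 0) (cbox (0, 0) (1, 1))"
    using integrable_integral[OF integrable_continuous[OF f]] by simp
  from has_integral_add[OF this integrable_integral[OF copula_integrable_on[OF C]]]
  show ?thesis unfolding copula_integral_def by (simp add: case_prod_unfold)
qed

lemma spearman_rho_eq:
  assumes C: "copula C"
  shows "spearman_rho C = 12 * copula_integral C - 3"
proof -
  let ?K = "copula_measure C" and ?S = "{0..1} \<times> {0..1} :: (real \<times> real) set"
  let ?L = "lborel \<Otimes>\<^sub>M lborel :: (real \<times> real) measure"
  note [measurable] = measurable_copula_measure
  interpret K: finite_measure ?K
    by standard (simp add: emeasure_copula_measure[OF C])
  interpret L: sigma_finite_measure ?L
    unfolding lborel_prod by (rule sigma_finite_lborel)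
  interpret KL: pair_sigma_finite ?K ?L by standard
  (* For fixed p this is the indicator of a rectangle of area fst p * snd p; integrating it in
     the other order turns the integral over dC into one of the survival function of C. *)
  define g :: "real \<times> real \<Rightarrow> real \<times> real \<Rightarrow> ennreal" where
    "g p q = (if 0 \<le> fst q \<and> fst q \<le> fst p \<and> 0 \<le> snd q \<and> snd q \<le> snd p then 1 else 0)" for p q
  have g_meas: "(\<lambda>(p, q). g p q) \<in> borel_measurable (?K \<Otimes>\<^sub>M ?L)"
    unfolding g_def case_prod_beta by measurable
  have area: "(\<integral>\<^sup>+q. g p q \<partial>?L) = ennreal (fst p * snd p)" if "p \<in> ?S" for p
  proof -
    have "(\<integral>\<^sup>+q. g p q \<partial>?L) = (\<integral>\<^sup>+q. indicator ({0..fst p} \<times> {0..snd p}) q \<partial>?L)"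
      by (intro nn_integral_cong) (auto simp: g_def split: split_indicator)
    also have "\<dots> = emeasure ?L ({0..fst p} \<times> {0..snd p})"
      by (intro nn_integral_indicator) auto
    also have "\<dots> = ennreal (fst p * snd p)"
      using that by (auto simp: lborel.emeasure_pair_measure_Times ennreal_mult)
    finally show ?thesis .
  qed
  have survival: "(\<integral>\<^sup>+p. g p q \<partial>?K) =
      ennreal (case q of (s, t) \<Rightarrow> 1 - s - t + C s t) * indicator ?S q" for q
  proof (cases "q \<in> ?S")
    case True
    obtain s t where q: "q = (s, t)" by (cases q)
    have "(\<integral>\<^sup>+p. g p q \<partial>?K) = (\<integral>\<^sup>+p. indicator ({s..1} \<times> {t..1}) p \<partial>?K)"
      using True by (intro nn_integral_cong) (auto simp: g_def q split: split_indicator)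
    also have "\<dots> = emeasure ?K ({s..1} \<times> {t..1})"
      using True by (intro nn_integral_indicator box_in_sets_copula_measure) (auto simp: q)
    also have "\<dots> = ennreal (box_volume C s 1 t 1)"
      using True by (intro emeasure_copula_measure[OF C]) (auto simp: q)
    also have "box_volume C s 1 t 1 = 1 - s - t + C s t"
      using copula_boundary[OF C] True by (simp add: box_volume_def q)
    finally show ?thesis using True by (simp add: q)
  next
    case False
    have "(\<integral>\<^sup>+p. g p q \<partial>?K) = (\<integral>\<^sup>+p. 0 \<partial>?K)"
      using False by (intro nn_integral_cong) (auto simp: g_def mem_Times_iff)
    then show ?thesis using False by simp
  qed
  have "(\<integral>\<^sup>+p. ennreal (fst p * snd p) \<partial>?K) = (\<integral>\<^sup>+p. (\<integral>\<^sup>+q. g p q \<partial>?L) \<partial>?K)"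
    by (intro nn_integral_cong) (simp add: area)
  also have "\<dots> = (\<integral>\<^sup>+q. (\<integral>\<^sup>+p. g p q \<partial>?K) \<partial>?L)"
    using KL.Fubini'[OF g_meas] by simp
  also have "\<dots> = (\<integral>\<^sup>+q. ennreal (case q of (s, t) \<Rightarrow> 1 - s - t + C s t) * indicator ?S q \<partial>lborel)"
    by (simp add: survival lborel_prod)
  also have "\<dots> = ennreal (copula_integral C)"
  proof (rule nn_integral_has_integral_lebesgue')
    show "0 \<le> (case q of (s, t) \<Rightarrow> 1 - s - t + C s t)" if "q \<in> ?S" for q
      using copula_bounds(2)[OF C, of "fst q" "snd q"] that by auto
  qed (use integral_survival_copula[OF C] in \<open>simp add: cbox_unit_square\<close>)
  finally have nn: "(\<integral>\<^sup>+p. ennreal (fst p * snd p) \<partial>?K) = ennreal (copula_integral C)" .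
  have "0 \<le> copula_integral C"
    unfolding copula_integral_def
    by (rule integral_nonneg[OF copula_integrable_on[OF C]])
      (use copula_bounds(1)[OF C] in \<open>auto simp: cbox_unit_square\<close>)
  then have "(\<integral>p. fst p * snd p \<partial>?K) = copula_integral C"
    using nn by (subst integral_eq_nn_integral) auto
  then show ?thesis
    by (simp add: spearman_rho_def concordance_def prod_copula_def case_prod_unfold)
qed

section \<open>The asymmetry bounds and their sharpness\<close>

lemma copula_integral_ge:
  assumes C: "copula C" and ab: "a \<in> {0..1}" "b \<in> {0..1}"
  defines "d \<equiv> C a b - (a + b - 1)"
  shows "1 / 6 + d * C a b * (C a b + d) / 2 \<le> copula_integral C"
proof -
  note bounds = copula_bounds[OF C ab]
  have "copula (least_copula_at a b (C a b))"
    using bounds by (intro copula_least_copula_at ab)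
  from copula_integral_mono[OF this C least_copula_at_le[OF C ab]]
  show ?thesis
    using copula_integral_least_copula_at[OF ab bounds(1,2,3,4)] by (simp add: d_def)
qed

lemma asymmetry_at_le:
  assumes C: "copula C" and ab: "a \<in> {0..1}" "b \<in> {0..1}"
    and e: "0 \<le> e" "e = C a b - C b a"
  shows "e \<le> \<bar>a - b\<bar>" "e \<le> 1 / 3"
    "e ^ 3 \<le> copula_integral C - 1 / 6" "3 * e ^ 3 \<le> 1 / 3 - copula_integral C"
proof -
  note bounds = copula_bounds[OF C ab(1) ab(2)] copula_bounds[OF C ab(2) ab(1)]
  \<comment> \<open>Both values are compared with a diagonal value: monotonicity bounds
    \<open>C b a\<close> below by it, and the Lipschitz property bounds \<open>C a b\<close>
    above.\<close>
  show dist: "e \<le> \<bar>a - b\<bar>"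
  proof (cases "a \<le> b")
    case True
    then have "C a a \<le> C b a" "\<bar>C a b - C a a\<bar> \<le> b - a"
      using ab by (auto intro!: copula_mono[OF C] copula_Lipschitz_2[OF C])
    then show ?thesis using e True by linarith
  next
    case False
    then have "C b b \<le> C b a" "\<bar>C a b - C b b\<bar> \<le> a - b"
      using ab by (auto intro!: copula_mono[OF C] copula_Lipschitz_1[OF C])
    then show ?thesis using e False by linarith
  qed
  \<comment> \<open>For a \<le> b, e is at most each of a, b - a and 1 - b, which sum to 1; the
    other case is symmetric.\<close>
  show "e \<le> 1 / 3" using dist bounds e ab by (auto simp: abs_if split: if_splits)
  show "e ^ 3 \<le> copula_integral C - 1 / 6"
  proof -
    let ?t = "C a b" and ?d = "C a b - (a + b - 1)"
    have "e \<le> ?t" "e \<le> ?d" using bounds e by auto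
    then have "e * e * (e + e) \<le> ?d * ?t * (?t + ?d)"
      using e(1) by (intro mult_mono add_mono) auto
    then show ?thesis
      using copula_integral_ge[OF C ab] by (simp add: power3_eq_cube)
  qed
  show "3 * e ^ 3 \<le> 1 / 3 - copula_integral C"
  proof -
    let ?t = "b - C b a" and ?d = "a - C b a"
    have t: "flip C b (1 - a) = ?t" "?t - (b + (1 - a) - 1) = ?d" by (simp_all add: flip_def)
    \<comment> \<open>The first two hold because \<open>C a b\<close> is at most \<open>b\<close>
      and \<open>a\<close>. Since \<open>?t\<close> and \<open>?d\<close> differ by |a - b| \<ge> e,
      the larger one is at least 2 * e, and the product below is at least 6 * e^3.\<close>
    have "e \<le> ?t" "e \<le> ?d" "2 * e \<le> max ?t ?d" using bounds e dist by auto
    then have "e * (2 * e) * (3 * e) \<le> min ?t ?d * max ?t ?d * (min ?t ?d + max ?t ?d)"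
      using e(1) by (intro mult_mono) auto
    also have "\<dots> = ?d * ?t * (?t + ?d)" by (auto simp: min_def max_def)
    finally show ?thesis
      using copula_integral_ge[OF copula_flip[OF C] ab(2), of "1 - a"] ab copula_integral_flip[OF C]
      unfolding t by (simp add: power3_eq_cube)
  qed
qed

lemma max_asymmetry_ge:
  "copula C \<Longrightarrow> a \<in> {0..1} \<Longrightarrow> b \<in> {0..1} \<Longrightarrow> \<bar>C a b - C b a\<bar> \<le> max_asymmetry C"
  using max_asymmetry_attained[of C] by fastforce

lemma max_asymmetry_symmetric:
  assumes C: "copula C" and "\<And>u v. u \<in> {0..1} \<Longrightarrow> v \<in> {0..1} \<Longrightarrow> C u v = C v u"
  shows "max_asymmetry C = 0"
  using max_asymmetry_attained[OF C] assms(2) by fastforce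

text \<open>All three bounds hold for every value of rho; the case distinction in
  \<open>asymmetry_bound\<close> selects the smallest. The two cubic ones come from the integral
  being (rho + 3) / 12.\<close>

lemma max_asymmetry_le:
  assumes C: "copula C"
  shows "0 \<le> max_asymmetry C \<and> max_asymmetry C \<le> asymmetry_bound (spearman_rho C)"
proof -
  let ?e = "max_asymmetry C" and ?r = "spearman_rho C"
  obtain a b where ab: "a \<in> {0..1}" "b \<in> {0..1}" and e: "?e = \<bar>C a b - C b a\<bar>"
    using max_asymmetry_attained[OF C] by blast
  obtain a b where ab: "a \<in> {0..1}" "b \<in> {0..1}" and e: "0 \<le> ?e" "?e = C a b - C b a"
  proof (cases "C b a \<le> C a b")
    case True
    then show ?thesis using that[OF ab] e by simp
  next
    case False
    then show ?thesis using that[OF ab(2) ab(1)] e by simp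
  qed
  note le = asymmetry_at_le[OF C ab e]
  have "?e ^ 3 \<le> (1 + ?r) / 12" "?e ^ 3 \<le> (1 - ?r) / 36"
    using le(3,4) by (simp_all add: spearman_rho_eq[OF C])
  then have "root 3 (?e ^ 3) \<le> root 3 ((1 + ?r) / 12)" "root 3 (?e ^ 3) \<le> root 3 ((1 - ?r) / 36)"
    by (intro real_root_le_mono; simp)+
  then show ?thesis
    using e(1) le(2) by (simp add: asymmetry_bound_def real_root_power_cancel)
qed

text \<open>The upper bound being known, one point where the asymmetry reaches it determines the
  maximum.\<close>

lemma asymmetry_bound_attainedI:
  assumes "copula C" "spearman_rho C = r" "a \<in> {0..1}" "b \<in> {0..1}" "C a b - C b a = asymmetry_bound r"
  shows "\<exists>C. copula C \<and> spearman_rho C = r \<and> max_asymmetry C = asymmetry_bound r"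
  using assms max_asymmetry_le[of C] max_asymmetry_ge[of C a b] by (intro exI[of _ C]) auto

section \<open>Copulas attaining the bounds\<close>

lemma symmetric_copula_exists:
  assumes r: "-1 \<le> r" "r \<le> 1"
  shows "\<exists>C. copula C \<and> spearman_rho C = r \<and> max_asymmetry C = 0"
proof -
  \<comment> \<open>On the unit square \<open>W\<close> is the lower Frechet-Hoeffding bound max(0,
    u + v - 1) and its flip is min(u, v), with rho equal to -1 and 1. The weight s solves (1 - s) *
    (-1) + s = r.\<close>
  define W where "W = least_copula_at 0 0 0"
  define s where "s = (r + 1) / 2"
  define C where "C = (\<lambda>u v. (1 - s) * W u v + s * flip W u v)"
  have W: "copula W" unfolding W_def by (rule copula_least_copula_at) auto
  have C: "copula C"
    unfolding C_def using r by (intro copula_convex W copula_flip) (auto simp: s_def)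
  have J: "copula_integral W = 1 / 6"
    using copula_integral_least_copula_at[of 0 0 0] by (simp add: W_def)
  have "copula_integral C = (1 - s) * (1 / 6) + s * (1 / 3)"
    unfolding C_def by (simp add: copula_integral_convex copula_integral_flip copula_flip W J)
  then have "spearman_rho C = r"
    by (simp add: spearman_rho_eq[OF C] s_def field_simps)
  moreover have "max_asymmetry C = 0"
    by (rule max_asymmetry_symmetric[OF C]) (auto simp: C_def W_def flip_def least_copula_at_def max_def)
  ultimately show ?thesis using C by blast
qed

text \<open>Since 1/3 + 2/3 - 1 = 0, both factors t and t - (a + b - 1) equal d, the equality case
  of the lower estimate. The value at the mirror point (2/3, 1/3) stays 0 as long as 0 \<le> d \<le>
  1/3.\<close>

definition low_rho_copula :: "real \<Rightarrow> real \<Rightarrow> real \<Rightarrow> real" where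
  "low_rho_copula d = least_copula_at (1 / 3) (2 / 3) d"

text \<open>The least copula passes through (b, 1 - a) for a = 1/3 and b = 1/3 + d. Its two factors
  are 2 * d and d, the equality case of the flipped estimate.\<close>

definition high_rho_copula :: "real \<Rightarrow> real \<Rightarrow> real \<Rightarrow> real" where
  "high_rho_copula d = flip (least_copula_at (1 / 3 + d) (2 / 3) (2 * d))"

lemma low_rho_copula:
  assumes d: "0 \<le> d" "d \<le> 1 / 3"
  shows "copula (low_rho_copula d)" "copula_integral (low_rho_copula d) = 1 / 6 + d ^ 3"
    "low_rho_copula d (1 / 3) (2 / 3) - low_rho_copula d (2 / 3) (1 / 3) = d"
  using d copula_least_copula_at[of "1 / 3" "2 / 3" d]
    copula_integral_least_copula_at[of "1 / 3" "2 / 3" d]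
  by (auto simp: low_rho_copula_def least_copula_at_def power3_eq_cube)

lemma high_rho_copula:
  assumes d: "0 \<le> d" "d \<le> 1 / 3"
  shows "copula (high_rho_copula d)" "copula_integral (high_rho_copula d) = 1 / 3 - 3 * d ^ 3"
    "high_rho_copula d (1 / 3) (1 / 3 + d) - high_rho_copula d (1 / 3 + d) (1 / 3) = d"
proof -
  let ?L = "least_copula_at (1 / 3 + d) (2 / 3) (2 * d)"
  have L: "copula ?L" using d by (intro copula_least_copula_at) auto
  then show "copula (high_rho_copula d)" by (simp add: high_rho_copula_def copula_flip)
  have "copula_integral ?L = 1 / 6 + (2 * d - (1 / 3 + d + 2 / 3 - 1)) * (2 * d) * (2 * d + (2 * d - (1 / 3 + d + 2 / 3 - 1))) / 2"
    using d by (intro copula_integral_least_copula_at) auto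
  then show "copula_integral (high_rho_copula d) = 1 / 3 - 3 * d ^ 3"
    by (simp add: high_rho_copula_def copula_integral_flip[OF L] power3_eq_cube)
  show "high_rho_copula d (1 / 3) (1 / 3 + d) - high_rho_copula d (1 / 3 + d) (1 / 3) = d"
    using d by (simp add: high_rho_copula_def flip_def least_copula_at_def)
qed

lemma asymmetry_bound_attained:
  assumes r: "-1 \<le> r" "r \<le> 1"
  shows "\<exists>C. copula C \<and> spearman_rho C = r \<and> max_asymmetry C = asymmetry_bound r"
proof -
  consider "r \<le> -5/9" | "-5/9 < r" "r \<le> -1/3" | "-1/3 < r" by linarith
  then show ?thesis
  proof cases
    case 1
    define d where "d = root 3 ((1 + r) / 12)"
    have d3: "d ^ 3 = (1 + r) / 12" unfolding d_def using r by (intro real_root_pow_pos2) auto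
    have d0: "0 \<le> d" unfolding d_def using r by simp
    \<comment> \<open>Cubes are compared: \<open>power_le_imp_le_base\<close> works with the
      exponent \<open>Suc n\<close>, so n = 2. At r = -5/9 the cube of d is exactly 1/27.\<close>
    moreover have "d \<le> 1 / 3"
      using d3 1 d0 by (intro power_le_imp_le_base[of d 2]) (auto simp: eval_nat_numeral)
    ultimately have d: "0 \<le> d" "d \<le> 1 / 3" .
    show ?thesis
    proof (rule asymmetry_bound_attainedI[OF low_rho_copula(1)[OF d]])
      show "spearman_rho (low_rho_copula d) = r"
        unfolding spearman_rho_eq[OF low_rho_copula(1)[OF d]] low_rho_copula(2)[OF d] d3 by (simp add: field_simps)
      show "low_rho_copula d (1 / 3) (2 / 3) - low_rho_copula d (2 / 3) (1 / 3) = asymmetry_bound r"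
        using 1 unfolding low_rho_copula(3)[OF d] by (simp add: asymmetry_bound_def d_def)
    qed auto
  next
    case 2
    \<comment> \<open>The two copulas mixed below have rho equal to -5/9 and -1/3, and s runs
      affinely from 0 to 1 between these values. Both have asymmetry 1/3 at the same point (1/3,
      2/3) with the same sign, so every mixture keeps it.\<close>
    define s where "s = (9 * r + 5) / 2"
    have s: "0 \<le> s" "s \<le> 1" using 2 by (auto simp: s_def)
    let ?A = "low_rho_copula (1 / 3)" and ?B = "high_rho_copula (1 / 3)"
    let ?C = "\<lambda>u v. (1 - s) * ?A u v + s * ?B u v"
    have A: "copula ?A" "copula_integral ?A = 1 / 6 + (1 / 3) ^ 3" "?A (1 / 3) (2 / 3) - ?A (2 / 3) (1 / 3) = 1 / 3"
      using low_rho_copula[of "1 / 3"] by auto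
    have B: "copula ?B" "copula_integral ?B = 1 / 3 - 3 * (1 / 3) ^ 3" "?B (1 / 3) (2 / 3) - ?B (2 / 3) (1 / 3) = 1 / 3"
      using high_rho_copula[of "1 / 3"] by auto
    have C: "copula ?C" by (intro copula_convex A B s)
    show ?thesis
    proof (rule asymmetry_bound_attainedI[OF C])
      show "spearman_rho ?C = r"
        unfolding spearman_rho_eq[OF C] copula_integral_convex[OF A(1) B(1)] A(2) B(2)
        by (simp add: s_def field_simps eval_nat_numeral)
      have "?C (1 / 3) (2 / 3) - ?C (2 / 3) (1 / 3) =
          (1 - s) * (?A (1 / 3) (2 / 3) - ?A (2 / 3) (1 / 3)) + s * (?B (1 / 3) (2 / 3) - ?B (2 / 3) (1 / 3))"
        by (simp add: algebra_simps)
      also have "\<dots> = asymmetry_bound r"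
        unfolding A(3) B(3) using 2 by (simp add: asymmetry_bound_def field_simps)
      finally show "?C (1 / 3) (2 / 3) - ?C (2 / 3) (1 / 3) = asymmetry_bound r" .
    qed auto
  next
    case 3
    define d where "d = root 3 ((1 - r) / 36)"
    have d3: "d ^ 3 = (1 - r) / 36" unfolding d_def using r by (intro real_root_pow_pos2) auto
    have d0: "0 \<le> d" unfolding d_def using r by simp
    moreover have "d \<le> 1 / 3"
      using d3 3 d0 by (intro power_le_imp_le_base[of d 2]) (auto simp: eval_nat_numeral)
    ultimately have d: "0 \<le> d" "d \<le> 1 / 3" .
    show ?thesis
    proof (rule asymmetry_bound_attainedI[OF high_rho_copula(1)[OF d]])
      show "spearman_rho (high_rho_copula d) = r"
        unfolding spearman_rho_eq[OF high_rho_copula(1)[OF d]] high_rho_copula(2)[OF d] d3 by (simp add: field_simps)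
      show "high_rho_copula d (1 / 3) (1 / 3 + d) - high_rho_copula d (1 / 3 + d) (1 / 3) = asymmetry_bound r"
        using 3 unfolding high_rho_copula(3)[OF d] by (simp add: asymmetry_bound_def d_def)
    qed (use d in auto)
  qed
qed

theorem corollary10:
  shows "(\<forall>C. copula C \<longrightarrow>
            0 \<le> max_asymmetry C \<and> max_asymmetry C \<le> asymmetry_bound (spearman_rho C)) \<and>
         (\<forall>r. -1 \<le> r \<and> r \<le> 1 \<longrightarrow>
            (\<exists>C. copula C \<and> spearman_rho C = r \<and> max_asymmetry C = 0) \<and>
            (\<exists>C. copula C \<and> spearman_rho C = r \<and> max_asymmetry C = asymmetry_bound r))"
  using max_asymmetry_le symmetric_copula_exists asymmetry_bound_attained by blast

end
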